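(* Let $A,B,\alpha,\beta,\gamma\in\mathbb{C}$ and let $\{f_{m,n}\}_{m,n\ge 0}$ be defined by $f_{m,n}=A^mB^n$ if $mn=0$ (with $0^0=1$), and $f_{m,n}=\alpha f_{m-1,n}+\beta f_{m,n-1}+\gamma f_{m-1,n-1}$ if $mn>0$. Let $G(z)=\sum_{n\ge0} f_{n,n}z^n$ and $S=S(z)=\sqrt{1+\gamma^2z^2-2(2\alpha\beta+\gamma)z}$, the branch analytic near $z=0$ with $S(0)=1$. Then, for all sufficiently small $z\neq 0$ at which the denominators below are nonzero, \[ G(z)=\frac{-B+\beta}{\beta-B+\alpha B^2z+\gamma Bz}+\frac{2\alpha z(\alpha B+\beta A-AB+\gamma)(-1+\gamma z+S)}{S\,(-1+2\alpha Bz+\gamma z+S)\,\big(2\alpha+A(-1+\gamma z+S)\big)}. \] *)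

theory Defs
  imports "HOL-Analysis.Analysis"
begin

fun lattice_f :: "complex \<Rightarrow> complex \<Rightarrow> complex \<Rightarrow> complex \<Rightarrow> complex \<Rightarrow> nat \<Rightarrow> nat \<Rightarrow> complex" where
  "lattice_f A B \<alpha> \<beta> \<gamma> 0 n = B ^ n"
| "lattice_f A B \<alpha> \<beta> \<gamma> (Suc m) 0 = A ^ Suc m"
| "lattice_f A B \<alpha> \<beta> \<gamma> (Suc m) (Suc n) =
     \<alpha> * lattice_f A B \<alpha> \<beta> \<gamma> m (Suc n) + \<beta> * lattice_f A B \<alpha> \<beta> \<gamma> (Suc m) n
     + \<gamma> * lattice_f A B \<alpha> \<beta> \<gamma> m n"

lemma lattice_f_boundary: "m * n = 0 \<Longrightarrow> lattice_f A B \<alpha> \<beta> \<gamma> m n = A ^ m * B ^ n"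
  by (cases m) auto

lemma lattice_f_rec:
  "m * n > 0 \<Longrightarrow> lattice_f A B \<alpha> \<beta> \<gamma> m n =
     \<alpha> * lattice_f A B \<alpha> \<beta> \<gamma> (m - 1) n + \<beta> * lattice_f A B \<alpha> \<beta> \<gamma> m (n - 1)
     + \<gamma> * lattice_f A B \<alpha> \<beta> \<gamma> (m - 1) (n - 1)"
  by (cases m; cases n) auto

definition diag_gf :: "complex \<Rightarrow> complex \<Rightarrow> complex \<Rightarrow> complex \<Rightarrow> complex \<Rightarrow> complex \<Rightarrow> complex" where
  "diag_gf A B \<alpha> \<beta> \<gamma> z = (\<Sum>n. lattice_f A B \<alpha> \<beta> \<gamma> n n * z ^ n)"

text \<open>Being analytic at 0 with value 1 there determines the square root only as a germ, so
  the equation for its square is required only near 0.\<close>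

definition is_sqrt_branch :: "complex \<Rightarrow> complex \<Rightarrow> complex \<Rightarrow> (complex \<Rightarrow> complex) \<Rightarrow> bool" where
  "is_sqrt_branch \<alpha> \<beta> \<gamma> S \<longleftrightarrow>
     S analytic_on {0} \<and> S 0 = 1 \<and>
     (\<forall>\<^sub>F z in nhds 0. (S z)\<^sup>2 = 1 + \<gamma>\<^sup>2 * z\<^sup>2 - 2 * (2 * \<alpha> * \<beta> + \<gamma>) * z)"

lemma is_sqrt_branch_csqrt:
  "is_sqrt_branch \<alpha> \<beta> \<gamma> (\<lambda>z. csqrt (1 + \<gamma>\<^sup>2 * z\<^sup>2 - 2 * (2 * \<alpha> * \<beta> + \<gamma>) * z))"
  unfolding is_sqrt_branch_def
  by (auto intro!: analytic_intros simp: complex_nonpos_Reals_iff)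

end

theory Submission
  imports Defs "HOL-Complex_Analysis.Complex_Analysis"
begin

text \<open>
  Since \<open>\<bar>f m n\<bar> \<le> C ^ (m + n)\<close>, the row series \<open>R n t = (\<Sum>m. f m n * t ^ m)\<close> converge near 0,
  and \<open>f n n\<close> is the residue of \<open>R n t / t ^ Suc n\<close> at 0.  Summing over \<open>n\<close> under the integral over
  a fixed small circle, \<open>G(z)\<close> becomes the contour integral of \<open>F(t, z/t) / t\<close>, where the bivariate
  generating function \<open>F\<close> is rational by the recurrence. For small \<open>z\<close> the poles inside
  the circle are \<open>t = B z\<close>, which contributes the first term of the formula, and the small root
  \<open>t1 = (1 - \<gamma> z - S) / (2 \<alpha>)\<close> of \<open>t - \<alpha> t\<^sup>2 - \<beta> z - \<gamma> t z\<close>, which contributes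
  the second.  If \<open>\<alpha> = 0\<close> then \<open>S = 1 - \<gamma> z\<close> near 0 and the denominator of the formula vanishes, so the claim is vacuous.
\<close>

context
  fixes A B \<alpha> \<beta> \<gamma> :: complex
begin

section \<open>Growth of the coefficients and convergence of the row series\<close>

abbreviation (input) f where "f \<equiv> lattice_f A B \<alpha> \<beta> \<gamma>"

text \<open>The sum dominates the boundary ratios A and B as well as
  \<open>norm \<alpha> + norm \<beta> + norm \<gamma>\<close>; the summand 1 makes its powers
  increasing.\<close>

definition growth :: real where
  "growth = 1 + norm A + norm B + norm \<alpha> + norm \<beta> + norm \<gamma>"

definition row_fps :: "nat \<Rightarrow> complex fps" where
  "row_fps n = Abs_fps (\<lambda>m. f m n)"

lemma growth_ge_1: "growth \<ge> 1"
  by (simp add: growth_def)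

text \<open>The recurrence multiplies the largest predecessor by at most
  \<open>norm \<alpha> + norm \<beta> + norm \<gamma>\<close>, so by at most one factor
  \<open>growth\<close>. The outer induction supplies the neighbours in column m, the inner one the
  neighbour \<open>f (Suc m) n\<close>.\<close>

lemma norm_lattice_f_le: "norm (f m n) \<le> growth ^ (m + n)"
proof (induction m arbitrary: n)
  case 0
  have "norm B \<le> growth" by (simp add: growth_def)
  then show ?case by (simp add: norm_power power_mono)
next
  case (Suc m)
  note outer_IH = Suc.IH
  show ?case
  proof (induction n)
    case 0
    have "norm A \<le> growth" by (simp add: growth_def)
    then have "norm A ^ Suc m \<le> growth ^ Suc m" by (intro power_mono) auto
    then show ?case by (simp add: norm_power norm_mult)
  next
    case (Suc n)
    have "norm (f (Suc m) (Suc n)) \<le> norm \<alpha> * norm (f m (Suc n)) + norm \<beta> * norm (f (Suc m) n)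
        + norm \<gamma> * norm (f m n)"
      by (simp, intro norm_triangle_le add_mono) (auto simp: norm_mult)
    also have "\<dots> \<le> norm \<alpha> * growth ^ Suc (m + n) + norm \<beta> * growth ^ Suc (m + n)
        + norm \<gamma> * growth ^ Suc (m + n)"
    proof (intro add_mono mult_left_mono)
      \<comment> \<open>The diagonal predecessor is two levels down, so its bound is raised by one
        power to match the others.\<close>
      have "growth ^ (m + n) \<le> growth ^ Suc (m + n)"
        using growth_ge_1 by (intro power_increasing) auto
      then show "norm (f m n) \<le> growth ^ Suc (m + n)" using outer_IH[of n] by simp
    qed (use Suc outer_IH[of "Suc n"] in auto)
    also have "\<dots> = (norm \<alpha> + norm \<beta> + norm \<gamma>) * growth ^ Suc (m + n)"
      by (simp add: algebra_simps)
    also have "\<dots> \<le> growth * growth ^ Suc (m + n)"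
      using growth_ge_1 by (intro mult_right_mono) (auto simp: growth_def)
    finally show ?case by simp
  qed
qed

lemma norm_row_term_le:
  "norm (f m n * t ^ m) \<le> growth ^ n * (growth * norm t) ^ m"
  using mult_right_mono[OF norm_lattice_f_le[of m n], of "norm t ^ m"]
  by (simp add: norm_mult norm_power power_add power_mult_distrib mult_ac)

lemma summable_row:
  assumes "growth * norm t < 1"
  shows "summable (\<lambda>m. f m n * t ^ m)"
proof (rule summable_comparison_test')
  show "summable (\<lambda>m. growth ^ n * (growth * norm t) ^ m)"
    using assms growth_ge_1 by (intro summable_mult summable_geometric) auto
qed (rule norm_row_term_le)

lemma row_sums:
  assumes "growth * norm t < 1"
  shows "(\<lambda>m. f m n * t ^ m) sums eval_fps (row_fps n) t"
  using summable_row[OF assms, of n] by (simp add: eval_fps_def row_fps_def summable_sums)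

lemma fps_conv_radius_row: "fps_conv_radius (row_fps n) \<ge> ereal (1 / growth)"
  unfolding fps_conv_radius_def
proof (rule conv_radius_geI_ex)
  fix r :: real assume r: "0 < r" "ereal r < ereal (1 / growth)"
  then have "growth * norm (complex_of_real r) < 1"
    using growth_ge_1 by (simp add: field_simps)
  then show "\<exists>z. norm z = r \<and> summable (\<lambda>m. fps_nth (row_fps n) m * z ^ m)"
    using r summable_row[of "of_real r" n] by (intro exI[of _ "of_real r"]) (auto simp: row_fps_def)
qed

text \<open>A bound uniform in t, needed for the M-test on the circle; the margin 1/2 makes the
  majorant sum to the constant 2.\<close>

lemma norm_row_le:
  assumes "growth * norm t \<le> 1 / 2"
  shows "norm (eval_fps (row_fps n) t) \<le> 2 * growth ^ n"
proof -
  have "(\<lambda>m. growth ^ n * (1 / 2) ^ m) sums (growth ^ n * 2)"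
    using sums_mult[OF geometric_sums[of "1/2::real"], of "growth ^ n"] by simp
  moreover have "(\<lambda>m. f m n * t ^ m) sums eval_fps (row_fps n) t"
    using assms by (intro row_sums) auto
  moreover have "norm (f m n * t ^ m) \<le> growth ^ n * (1 / 2) ^ m" for m
  proof -
    have "(growth * norm t) ^ m \<le> (1 / 2) ^ m"
      using assms growth_ge_1 by (intro power_mono) auto
    then have "growth ^ n * (growth * norm t) ^ m \<le> growth ^ n * (1 / 2) ^ m"
      using growth_ge_1 by (intro mult_left_mono) auto
    then show ?thesis using norm_row_term_le[of m n t] by linarith
  qed
  ultimately have "norm (eval_fps (row_fps n) t) \<le> growth ^ n * 2"
    by (metis (no_types, lifting) norm_sums_le)
  then show ?thesis by (simp add: mult.commute)
qed

section \<open>The recurrence between rows and the bivariate generating function\<close>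

lemma eval_row_0:
  assumes "growth * norm t < 1"
  shows "eval_fps (row_fps 0) t = 1 / (1 - A * t)"
proof -
  have "norm (A * t) \<le> growth * norm t"
    by (auto simp: norm_mult growth_def intro!: mult_right_mono)
  then have "(\<lambda>m. (A * t) ^ m) sums (1 / (1 - A * t))"
    using assms by (intro geometric_sums) auto
  moreover have "f m 0 = A ^ m" for m by (cases m) auto
  ultimately show ?thesis
    using row_sums[OF assms, of 0] by (simp add: power_mult_distrib sums_unique2)
qed

text \<open>Multiply the recurrence by \<open>t ^ Suc m\<close> and sum over m. The sums starting at
  \<open>Suc m\<close> miss the boundary terms \<open>B ^ Suc n\<close> and \<open>B ^ n\<close>,
  which leave \<open>B ^ n * (B - \<beta>)\<close>.\<close>

lemma eval_row_Suc:
  assumes "growth * norm t < 1"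
  shows "(1 - \<alpha> * t) * eval_fps (row_fps (Suc n)) t = (\<beta> + \<gamma> * t) * eval_fps (row_fps n) t + B ^ n * (B - \<beta>)"
proof -
  define R where "R n = eval_fps (row_fps n) t" for n
  have S: "(\<lambda>m. f (Suc m) n * t ^ Suc m) sums (R n - B ^ n)" for n
    using row_sums[OF assms, of n] sums_Suc_iff[of "\<lambda>m. f m n * t ^ m" "R n - B ^ n"] by (simp add: R_def)
  have "(\<lambda>m. \<alpha> * t * (f m (Suc n) * t ^ m) + \<beta> * (f (Suc m) n * t ^ Suc m) + \<gamma> * t * (f m n * t ^ m))
      sums (\<alpha> * t * R (Suc n) + \<beta> * (R n - B ^ n) + \<gamma> * t * R n)"
    using S row_sums[OF assms] unfolding R_def by (intro sums_add sums_mult) auto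
  also have "(\<lambda>m. \<alpha> * t * (f m (Suc n) * t ^ m) + \<beta> * (f (Suc m) n * t ^ Suc m) + \<gamma> * t * (f m n * t ^ m))
      = (\<lambda>m. f (Suc m) (Suc n) * t ^ Suc m)"
    by (simp add: algebra_simps)
  finally have "R (Suc n) - B ^ Suc n = \<alpha> * t * R (Suc n) + \<beta> * (R n - B ^ n) + \<gamma> * t * R n"
    by (rule sums_unique2[OF S])
  then show ?thesis by (simp add: R_def algebra_simps)
qed

text \<open>Summing \<open>eval_row_Suc\<close> against \<open>y ^ Suc n\<close> gives a linear
  equation for the generating function. It is not divided by the kernel, whose zeros are excluded
  later and only on the circle.\<close>

lemma rows_gf:
  assumes t: "growth * norm t \<le> 1 / 2" and y: "growth * norm y \<le> 1 / 2"
  shows "summable (\<lambda>n. eval_fps (row_fps n) t * y ^ n)"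
    and "(1 - \<alpha> * t - \<beta> * y - \<gamma> * t * y) * (\<Sum>n. eval_fps (row_fps n) t * y ^ n)
      = (1 - \<alpha> * t) / (1 - A * t) + (B - \<beta>) * y / (1 - B * y)"
proof -
  define R where "R n = eval_fps (row_fps n) t" for n
  have bound: "norm (R n * y ^ n) \<le> 2 * (1 / 2) ^ n" for n
  proof -
    have "norm (R n * y ^ n) \<le> 2 * growth ^ n * norm y ^ n"
      using norm_row_le[OF t] by (auto simp: R_def norm_mult norm_power intro!: mult_right_mono)
    also have "\<dots> = 2 * (growth * norm y) ^ n" by (simp add: power_mult_distrib)
    also have "\<dots> \<le> 2 * (1 / 2) ^ n"
      using y growth_ge_1 by (intro mult_left_mono power_mono) auto
    finally show ?thesis .
  qed
  show sm: "summable (\<lambda>n. R n * y ^ n)"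
    by (rule summable_comparison_test'[OF summable_mult[OF summable_geometric[of "1/2::real"]] bound]) simp
  define F where "F = (\<Sum>n. R n * y ^ n)"
  have F: "(\<lambda>n. R n * y ^ n) sums F" using sm by (simp add: F_def summable_sums)
  have "norm (B * y) \<le> growth * norm y"
    by (auto simp: norm_mult growth_def intro!: mult_right_mono)
  then have "(\<lambda>n. (B * y) ^ n) sums (1 / (1 - B * y))"
    using y by (intro geometric_sums) auto
  then have "(\<lambda>n. (\<beta> + \<gamma> * t) * y * (R n * y ^ n) + (B - \<beta>) * y * (B * y) ^ n)
      sums ((\<beta> + \<gamma> * t) * y * F + (B - \<beta>) * y * (1 / (1 - B * y)))"
    by (intro sums_add sums_mult F)
  also have "(\<lambda>n. (\<beta> + \<gamma> * t) * y * (R n * y ^ n) + (B - \<beta>) * y * (B * y) ^ n)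
      = (\<lambda>n. (1 - \<alpha> * t) * (R (Suc n) * y ^ Suc n))"
  proof
    fix n
    show "(\<beta> + \<gamma> * t) * y * (R n * y ^ n) + (B - \<beta>) * y * (B * y) ^ n
      = (1 - \<alpha> * t) * (R (Suc n) * y ^ Suc n)"
    proof -
      have "(1 - \<alpha> * t) * (R (Suc n) * y ^ Suc n) = ((1 - \<alpha> * t) * R (Suc n)) * y ^ Suc n" by simp
      also have "(1 - \<alpha> * t) * R (Suc n) = (\<beta> + \<gamma> * t) * R n + B ^ n * (B - \<beta>)"
        unfolding R_def by (rule eval_row_Suc) (use t in auto)
      finally show ?thesis by (simp add: algebra_simps power_mult_distrib)
    qed
  qed
  finally have rec: "(\<lambda>n. (1 - \<alpha> * t) * (R (Suc n) * y ^ Suc n))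
      sums ((\<beta> + \<gamma> * t) * y * F + (B - \<beta>) * y * (1 / (1 - B * y)))" .
  \<comment> \<open>The same series as an index shift of F; comparing the two sums gives the
    equation for F.\<close>
  have "(\<lambda>n. (1 - \<alpha> * t) * (R (Suc n) * y ^ Suc n)) sums ((1 - \<alpha> * t) * (F - R 0))"
    using F sums_Suc_iff[of "\<lambda>n. R n * y ^ n" "F - R 0"] by (intro sums_mult) simp
  from sums_unique2[OF this rec]
  have "(1 - \<alpha> * t) * (F - R 0) = (\<beta> + \<gamma> * t) * y * F + (B - \<beta>) * y * (1 / (1 - B * y))" .
  moreover have "R 0 = 1 / (1 - A * t)" unfolding R_def by (rule eval_row_0) (use t in auto)
  ultimately show "(1 - \<alpha> * t - \<beta> * y - \<gamma> * t * y) * (\<Sum>n. R n * y ^ n)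
      = (1 - \<alpha> * t) / (1 - A * t) + (B - \<beta>) * y / (1 - B * y)"
    unfolding F_def[symmetric] by (simp add: algebra_simps)
qed

section \<open>The diagonal as a contour integral and its evaluation by residues\<close>

lemma contour_integral_row:
  assumes r: "0 < r" "growth * r < 1"
  shows "((\<lambda>t. eval_fps (row_fps n) t / t ^ Suc n) has_contour_integral 2 * of_real pi * \<i> * f n n) (circlepath 0 r)"
proof -
  have "ereal r < ereal (1 / growth)"
    using r growth_ge_1 by (simp add: field_simps)
  then have conv: "ereal r < fps_conv_radius (row_fps n)"
    using fps_conv_radius_row by (rule less_le_trans)
  have sub: "cball (0 :: complex) r \<subseteq> eball 0 (fps_conv_radius (row_fps n))"
  proof
    fix t :: complex assume "t \<in> cball 0 r"
    then have "ereal (norm t) \<le> ereal r" by simp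
    then show "t \<in> eball 0 (fps_conv_radius (row_fps n))"
      using le_less_trans[OF _ conv] by (simp add: in_eball_iff)
  qed
  have "0 < ereal r" using r by simp
  then have pos: "fps_conv_radius (row_fps n) > 0"
    using conv by (rule less_trans)
  have "((\<lambda>t. eval_fps (row_fps n) t / (t - 0) ^ Suc n) has_contour_integral
      2 * pi * \<i> / fact n * (deriv ^^ n) (eval_fps (row_fps n)) 0) (circlepath 0 r)"
    using r sub
    by (intro Cauchy_has_contour_integral_higher_derivative_circlepath
          holomorphic_on_imp_continuous_on holomorphic_on_eval_fps) auto
  \<comment> \<open>Row n is read at its own index, giving the diagonal entry; the
    \<open>fact n\<close> in the derivative cancels the one in Cauchy's formula.\<close>
  moreover have "fps_nth (row_fps n) n = f n n"
    by (simp add: row_fps_def)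
  then have "(deriv ^^ n) (eval_fps (row_fps n)) 0 = fact n * f n n"
    unfolding fps_nth_conv_deriv[OF pos, of n] by (simp add: divide_eq_eq mult.commute)
  ultimately show ?thesis by (simp add: mult.assoc)
qed

text \<open>Sum and integral are interchanged by uniform convergence on the circle, where
  \<open>rows_gf\<close> at \<open>y = z / t\<close> gives the integrand in closed form. The value I
  stays abstract, so that evaluating the integral is a separate task.\<close>

lemma diagonal_sums_contour_integral:
  assumes r: "r = 1 / (4 * growth)" and z: "growth\<^sup>2 * norm z \<le> 1 / 8"
    and nz: "\<And>t. norm t = r \<Longrightarrow> t * (1 - \<gamma> * z) - \<alpha> * t\<^sup>2 - \<beta> * z \<noteq> 0"
    and I: "((\<lambda>t. ((1 - \<alpha> * t) / (1 - A * t) + (B - \<beta>) * z / (t - B * z))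
      / (t * (1 - \<gamma> * z) - \<alpha> * t\<^sup>2 - \<beta> * z)) has_contour_integral 2 * of_real pi * \<i> * I) (circlepath 0 r)"
      (is "(?h has_contour_integral _) _")
  shows "(\<lambda>n. f n n * z ^ n) sums I"
proof -
  have r0: "r > 0" and Cr: "growth * r = 1 / 4"
    using r growth_ge_1 by auto
  \<comment> \<open>On the circle \<open>growth * norm t\<close> is 1/4, and
    \<open>growth * norm (z / t)\<close> is \<open>4 * growth\<^sup>2 * norm z\<close>, at most 1/2
    by the bound 1/8.\<close>
  have t: "growth * norm t \<le> 1 / 2" and y: "growth * norm (z / t) \<le> 1 / 2" and t0: "t \<noteq> 0"
    if "norm t = r" for t
    using that r r0 Cr z by (auto simp: norm_divide power2_eq_square mult_ac)
  define g where "g n t = eval_fps (row_fps n) t / t ^ Suc n * z ^ n" for n t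
  have g_int: "(g n has_contour_integral 2 * of_real pi * \<i> * (f n n * z ^ n)) (circlepath 0 r)" for n
    using has_contour_integral_rmul[OF contour_integral_row[OF r0, of n], of "z ^ n"] Cr
    by (simp add: g_def[abs_def] mult_ac)
  have g_eq: "g n t = eval_fps (row_fps n) t * (z / t) ^ n / t" for n t
    by (simp add: g_def power_divide)
  have g_bound: "norm (g n t) \<le> 2 * (1 / 2) ^ n / r" if "t \<in> sphere 0 r" for n t
  proof -
    have "norm (eval_fps (row_fps n) t * (z / t) ^ n) \<le> 2 * growth ^ n * norm (z / t) ^ n"
      using that norm_row_le[OF t] by (auto simp del: norm_divide simp: norm_mult norm_power intro!: mult_right_mono)
    also have "\<dots> = 2 * (growth * norm (z / t)) ^ n" by (simp add: power_mult_distrib)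
    also have "\<dots> \<le> 2 * (1 / 2) ^ n"
      using that y[of t] growth_ge_1 by (intro mult_left_mono power_mono) auto
    finally show ?thesis
      using that r0 by (simp add: g_eq norm_divide divide_right_mono)
  qed
  have uni: "uniform_limit (sphere 0 r) (\<lambda>N t. \<Sum>n<N. g n t) (\<lambda>t. \<Sum>n. g n t) sequentially"
    by (intro Weierstrass_m_test[OF g_bound] summable_divide summable_mult summable_geometric) auto
  have part: "((\<lambda>t. \<Sum>n<N. g n t) has_contour_integral (\<Sum>n<N. 2 * of_real pi * \<i> * (f n n * z ^ n)))
      (circlepath 0 r)" for N
    by (intro has_contour_integral_sum g_int) auto
  have lim: "(\<lambda>N. contour_integral (circlepath 0 r) (\<lambda>t. \<Sum>n<N. g n t)) \<longlonglongrightarrow>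
      contour_integral (circlepath 0 r) (\<lambda>t. \<Sum>n. g n t)"
    using r0 uni
    by (intro contour_integral_uniform_limit_circlepath(2) always_eventually allI
          has_contour_integral_integrable[OF part]) auto
  have "(\<Sum>n. g n t) = ?h t" if t': "norm t = r" for t
  proof -
    let ?F = "\<Sum>n. eval_fps (row_fps n) t * (z / t) ^ n"
    note gf = rows_gf[OF t[OF t'] y[OF t']]
    \<comment> \<open>The factor 1/t of the integrand turns the kernel at \<open>y = z / t\<close>
      into a quadratic in t.\<close>
    have "(1 - \<alpha> * t - \<beta> * (z / t) - \<gamma> * t * (z / t)) * t = t * (1 - \<gamma> * z) - \<alpha> * t\<^sup>2 - \<beta> * z"
      using t0[OF t'] by (simp add: field_simps power2_eq_square)
    moreover have "(B - \<beta>) * (z / t) / (1 - B * (z / t)) = (B - \<beta>) * z / (t - B * z)"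
      using t0[OF t'] by (simp add: divide_simps)
    ultimately have "(t * (1 - \<gamma> * z) - \<alpha> * t\<^sup>2 - \<beta> * z) * (?F / t)
        = (1 - \<alpha> * t) / (1 - A * t) + (B - \<beta>) * z / (t - B * z)"
      using gf(2) t0[OF t'] by (simp flip: \<open>_ * t = _\<close>)
    moreover have "(\<Sum>n. g n t) = ?F / t"
      unfolding g_eq by (rule suminf_divide[OF gf(1)])
    ultimately show ?thesis
      using nz[OF t'] by (metis nonzero_mult_div_cancel_left)
  qed
  then have "((\<lambda>t. \<Sum>n. g n t) has_contour_integral 2 * of_real pi * \<i> * I) (circlepath 0 r)"
    using r0 by (intro has_contour_integral_eq[OF I]) auto
  then have "(\<lambda>n. 2 * of_real pi * \<i> * (f n n * z ^ n)) sums (2 * of_real pi * \<i> * I)"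
    using lim contour_integral_unique[OF part] by (simp add: sums_def contour_integral_unique)
  then show ?thesis by (simp add: sums_mult_iff)
qed

text \<open>Here s is the derivative of K at its root t1, so dividing by s gives the residues at t1;
  \<open>c / K w\<close> is the residue at w. The bound on s keeps any other root of K more than 2r
  away from t1, hence outside the disc, and \<open>norm A * r < 1\<close> does the same for the pole
  1/A.\<close>

lemma kernel_contour_integral:
  assumes t1: "norm t1 < r" and w: "norm w < r" and neq: "w \<noteq> t1"
    and A: "norm A * r < 1" and s: "norm \<alpha> * (2 * r) < norm s"
    and K: "\<And>t. K t = (t - t1) * (s - \<alpha> * (t - t1))"
  shows "((\<lambda>t. ((1 - \<alpha> * t) / (1 - A * t) + c / (t - w)) / K t) has_contour_integral
      2 * of_real pi * \<i> * ((1 - \<alpha> * t1) / ((1 - A * t1) * s) + c / K w - c / ((w - t1) * s)))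
      (circlepath 0 r)"
    and "\<And>t. norm t = r \<Longrightarrow> K t \<noteq> 0"
proof -
  have r: "r > 0" using t1 by (auto intro: le_less_trans[OF norm_ge_zero])
  \<comment> \<open>The cofactor of \<open>t - t1\<close> in K; it has no zero in the closed disc,
    so Cauchy's formula sees only t1 and w.\<close>
  define L where "L t = s - \<alpha> * (t - t1)" for t
  have L: "L t \<noteq> 0" if "norm t \<le> r" for t
  proof
    assume "L t = 0"
    then have "norm s = norm \<alpha> * norm (t - t1)" by (simp add: L_def norm_mult[symmetric])
    also have "\<dots> \<le> norm \<alpha> * (2 * r)"
      using that t1 norm_triangle_ineq4[of t t1] by (intro mult_left_mono) auto
    finally show False using s by simp
  qed
  have A1: "1 - A * t \<noteq> 0" if "norm t \<le> r" for t
  proof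
    assume "1 - A * t = 0"
    then have "norm A * norm t = 1" by (metis eq_iff_diff_eq_0 norm_mult norm_one)
    with that A mult_left_mono[of "norm t" r "norm A"] show False by simp
  qed
  show "K t \<noteq> 0" if "norm t = r" for t
    using that t1 L[of t] by (auto simp: K L_def)
  have "L holomorphic_on cball 0 r" unfolding L_def by (intro holomorphic_intros)
  then have "(\<lambda>t. (1 - \<alpha> * t) / ((1 - A * t) * L t)) holomorphic_on cball 0 r"
    and invL: "(\<lambda>t. c / (w - t1) / L t) holomorphic_on cball 0 r"
    using L A1 neq by (auto intro!: holomorphic_intros)
  then have "((\<lambda>t. (1 - \<alpha> * t) / ((1 - A * t) * L t) / (t - t1)) has_contour_integral
      2 * of_real pi * \<i> * ((1 - \<alpha> * t1) / ((1 - A * t1) * L t1))) (circlepath 0 r)"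
    by (intro Cauchy_integral_circlepath_simple) (use t1 in auto)
  moreover have "((\<lambda>t. c / (w - t1) / L t / (t - w)) has_contour_integral
      2 * of_real pi * \<i> * (c / (w - t1) / L w)) (circlepath 0 r)"
    by (intro Cauchy_integral_circlepath_simple invL) (use w in auto)
  moreover have "((\<lambda>t. c / (w - t1) / L t / (t - t1)) has_contour_integral
      2 * of_real pi * \<i> * (c / (w - t1) / L t1)) (circlepath 0 r)"
    by (intro Cauchy_integral_circlepath_simple invL) (use t1 in auto)
  ultimately have "((\<lambda>t. (1 - \<alpha> * t) / ((1 - A * t) * L t) / (t - t1)
        + c / (w - t1) / L t / (t - w) - c / (w - t1) / L t / (t - t1)) has_contour_integral
      2 * of_real pi * \<i> * ((1 - \<alpha> * t1) / ((1 - A * t1) * L t1))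
        + 2 * of_real pi * \<i> * (c / (w - t1) / L w) - 2 * of_real pi * \<i> * (c / (w - t1) / L t1)) (circlepath 0 r)"
    by (intro has_contour_integral_diff has_contour_integral_add)
  moreover have "2 * of_real pi * \<i> * ((1 - \<alpha> * t1) / ((1 - A * t1) * L t1))
        + 2 * of_real pi * \<i> * (c / (w - t1) / L w) - 2 * of_real pi * \<i> * (c / (w - t1) / L t1)
      = 2 * of_real pi * \<i> * ((1 - \<alpha> * t1) / ((1 - A * t1) * s) + c / K w - c / ((w - t1) * s))"
    by (simp add: K L_def algebra_simps)
  ultimately have I: "((\<lambda>t. (1 - \<alpha> * t) / ((1 - A * t) * L t) / (t - t1)
        + c / (w - t1) / L t / (t - w) - c / (w - t1) / L t / (t - t1)) has_contour_integral
      2 * of_real pi * \<i> * ((1 - \<alpha> * t1) / ((1 - A * t1) * s) + c / K w - c / ((w - t1) * s)))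
      (circlepath 0 r)"
    by simp
  show "((\<lambda>t. ((1 - \<alpha> * t) / (1 - A * t) + c / (t - w)) / K t) has_contour_integral
      2 * of_real pi * \<i> * ((1 - \<alpha> * t1) / ((1 - A * t1) * s) + c / K w - c / ((w - t1) * s)))
      (circlepath 0 r)"
  proof (rule has_contour_integral_eq[OF I])
    fix t assume "t \<in> path_image (circlepath 0 r)"
    then have "norm t = r" using r by simp
    then have nz: "L t \<noteq> 0" "1 - A * t \<noteq> 0" "t - t1 \<noteq> 0" "t - w \<noteq> 0" "w - t1 \<noteq> 0"
      using L[of t] A1[of t] t1 w neq by auto
    \<comment> \<open>partial fractions: the two poles are separated so that Cauchy's formula applies to each\<close>
    have "c / (w - t1) / L t / (t - w) - c / (w - t1) / L t / (t - t1) = c / (t - w) / (L t * (t - t1))"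
      using nz by (simp add: divide_simps) (simp add: algebra_simps)
    then show "(1 - \<alpha> * t) / ((1 - A * t) * L t) / (t - t1) + c / (w - t1) / L t / (t - w)
        - c / (w - t1) / L t / (t - t1) = ((1 - \<alpha> * t) / (1 - A * t) + c / (t - w)) / K t"
      by (simp add: K L_def[symmetric] add_divide_distrib mult_ac add_diff_eq[symmetric])
  qed
qed

section \<open>Convergence of the diagonal series and simplification of the residues\<close>

lemma summable_diagonal:
  assumes "growth\<^sup>2 * norm z < 1"
  shows "summable (\<lambda>n. f n n * z ^ n)"
proof (rule summable_comparison_test')
  show "summable (\<lambda>n. (growth\<^sup>2 * norm z) ^ n)"
    using assms by (intro summable_geometric) auto
  show "norm (f n n * z ^ n) \<le> (growth\<^sup>2 * norm z) ^ n" for n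
    \<comment> \<open>The row bound is reused with the row index equal to the column index and z in
      place of t.\<close>
    using norm_row_term_le[of n n z]
    by (simp add: power_mult_distrib mult_ac power2_eq_square)
qed

text \<open>The residue at \<open>B * z\<close> becomes the first fraction after cancelling z. The
  two terms from t1 share the denominator \<open>s * (B * z - t1) * (1 - A * t1)\<close>, and the
  quadratic equation of t1 reduces their numerator to that of the second fraction.\<close>

lemma residue_sum_eq:
  assumes \<alpha>: "\<alpha> \<noteq> 0" and z: "z \<noteq> 0" and t1: "t1 = (1 - \<gamma> * z - s) / (2 * \<alpha>)"
    and s2: "s\<^sup>2 = 1 + \<gamma>\<^sup>2 * z\<^sup>2 - 2 * (2 * \<alpha> * \<beta> + \<gamma>) * z"
    and s: "s \<noteq> 0" and d1: "B * z \<noteq> t1" and d2: "1 - A * t1 \<noteq> 0"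
  shows "(1 - \<alpha> * t1) / ((1 - A * t1) * s)
      + (B - \<beta>) * z / (B * z * (1 - \<gamma> * z) - \<alpha> * (B * z)\<^sup>2 - \<beta> * z)
      - (B - \<beta>) * z / ((B * z - t1) * s)
    = (- B + \<beta>) / (\<beta> - B + \<alpha> * B\<^sup>2 * z + \<gamma> * B * z)
      + (2 * \<alpha> * z * (\<alpha> * B + \<beta> * A - A * B + \<gamma>) * (- 1 + \<gamma> * z + s))
        / (s * (- 1 + 2 * \<alpha> * B * z + \<gamma> * z + s) * (2 * \<alpha> + A * (- 1 + \<gamma> * z + s)))"
proof -
  have s_eq: "- 1 + \<gamma> * z + s = - 2 * \<alpha> * t1" using \<alpha> t1 by simp
  \<comment> \<open>The formula for t1 makes it a root of the kernel; squaring
    \<open>s = 1 - \<gamma> * z - 2 * \<alpha> * t1\<close> recovers the equation up to the factor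
    \<open>4 * \<alpha>\<close>.\<close>
  have q: "\<alpha> * t1\<^sup>2 = t1 * (1 - \<gamma> * z) - \<beta> * z"
  proof -
    have "(1 - \<gamma> * z - 2 * \<alpha> * t1)\<^sup>2 = 1 + \<gamma>\<^sup>2 * z\<^sup>2 - 2 * (2 * \<alpha> * \<beta> + \<gamma>) * z"
      using s2 t1 \<alpha> by simp
    then have "4 * \<alpha> * (\<alpha> * t1\<^sup>2 - (t1 * (1 - \<gamma> * z) - \<beta> * z)) = 0"
      by (simp add: algebra_simps power2_eq_square)
    with \<alpha> show ?thesis by simp
  qed
  have "B * z * (1 - \<gamma> * z) - \<alpha> * (B * z)\<^sup>2 - \<beta> * z
      = z * - (\<beta> - B + \<alpha> * B\<^sup>2 * z + \<gamma> * B * z)"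
    by (simp add: algebra_simps power2_eq_square)
  \<comment> \<open>Where the denominator vanishes, both fractions are 0 by the convention for
    division by 0.\<close>
  then have "(B - \<beta>) * z / (B * z * (1 - \<gamma> * z) - \<alpha> * (B * z)\<^sup>2 - \<beta> * z)
      = (- B + \<beta>) / (\<beta> - B + \<alpha> * B\<^sup>2 * z + \<gamma> * B * z)"
    using z by (simp add: divide_simps) (simp add: algebra_simps)
  moreover have "(2 * \<alpha> * z * (\<alpha> * B + \<beta> * A - A * B + \<gamma>) * (- 1 + \<gamma> * z + s))
        / (s * (- 1 + 2 * \<alpha> * B * z + \<gamma> * z + s) * (2 * \<alpha> + A * (- 1 + \<gamma> * z + s)))
      = - (z * t1 * (\<alpha> * B + \<beta> * A - A * B + \<gamma>)) / (s * (B * z - t1) * (1 - A * t1))"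
  proof -
    have "- 1 + 2 * \<alpha> * B * z + \<gamma> * z + s = 2 * \<alpha> * (B * z - t1)"
      using s_eq by (simp add: algebra_simps)
    moreover have "2 * \<alpha> + A * (- 1 + \<gamma> * z + s) = 2 * \<alpha> * (1 - A * t1)"
      unfolding s_eq by (simp add: algebra_simps)
    ultimately show ?thesis
      unfolding s_eq using \<alpha> by (simp add: divide_simps)
  qed
  moreover have "(1 - \<alpha> * t1) / ((1 - A * t1) * s) - (B - \<beta>) * z / ((B * z - t1) * s)
      = - (z * t1 * (\<alpha> * B + \<beta> * A - A * B + \<gamma>)) / (s * (B * z - t1) * (1 - A * t1))"
  proof -
    have "(1 - \<alpha> * t1) * (B * z - t1) - (B - \<beta>) * z * (1 - A * t1)
        = (\<alpha> * t1\<^sup>2 - t1 + \<beta> * z) - z * t1 * (\<alpha> * B + \<beta> * A - A * B)"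
      by (simp add: algebra_simps power2_eq_square)
    also have "\<dots> = - (z * t1 * (\<alpha> * B + \<beta> * A - A * B + \<gamma>))"
      \<comment> \<open>The quadratic part collapses to \<open>- \<gamma> * z * t1\<close>, which
        supplies the summand \<gamma>.\<close>
      unfolding q by (simp add: algebra_simps)
    finally have "- (z * t1 * (\<alpha> * B + \<beta> * A - A * B + \<gamma>))
        = (1 - \<alpha> * t1) * (B * z - t1) - (B - \<beta>) * z * (1 - A * t1)" ..
    then show ?thesis
      using s d1 d2 by (simp add: diff_divide_distrib mult_ac)
  qed
  ultimately show ?thesis by simp
qed

end

section \<open>The formula for all small nonzero z\<close>

theorem theorem3p1:
  fixes A B \<alpha> \<beta> \<gamma> :: complex and S :: "complex \<Rightarrow> complex"
  assumes "is_sqrt_branch \<alpha> \<beta> \<gamma> S"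
  shows "\<forall>\<^sub>F z in at 0.
    summable (\<lambda>n. lattice_f A B \<alpha> \<beta> \<gamma> n n * z ^ n) \<and>
    (\<beta> - B + \<alpha> * B\<^sup>2 * z + \<gamma> * B * z \<noteq> 0 \<longrightarrow>
     S z * (- 1 + 2 * \<alpha> * B * z + \<gamma> * z + S z) * (2 * \<alpha> + A * (- 1 + \<gamma> * z + S z)) \<noteq> 0 \<longrightarrow>
     diag_gf A B \<alpha> \<beta> \<gamma> z =
       (- B + \<beta>) / (\<beta> - B + \<alpha> * B\<^sup>2 * z + \<gamma> * B * z)
       + (2 * \<alpha> * z * (\<alpha> * B + \<beta> * A - A * B + \<gamma>) * (- 1 + \<gamma> * z + S z))
         / (S z * (- 1 + 2 * \<alpha> * B * z + \<gamma> * z + S z) * (2 * \<alpha> + A * (- 1 + \<gamma> * z + S z))))"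
proof -
  define C where "C = growth A B \<alpha> \<beta> \<gamma>"
  define r where "r = 1 / (4 * C)"
  define T where "T z = (1 - \<gamma> * z - S z) / (2 * \<alpha>)" for z
  have C: "C \<ge> 1" unfolding C_def by (rule growth_ge_1)
  have r: "r > 0" "C * r = 1 / 4" using C by (auto simp: r_def)
  have "norm \<alpha> \<le> C" "norm A \<le> C" "norm B \<le> C" by (auto simp: C_def growth_def)
  have "S 0 = 1" and S2: "\<forall>\<^sub>F z in nhds 0. (S z)\<^sup>2 = 1 + \<gamma>\<^sup>2 * z\<^sup>2 - 2 * (2 * \<alpha> * \<beta> + \<gamma>) * z"
    and "isCont S 0"
    using assms by (auto simp: is_sqrt_branch_def intro: analytic_at_imp_isCont)
  then have S: "S \<midarrow>0\<rightarrow> 1" by (simp add: isCont_def)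
  \<comment> \<open>With the constant factor \<open>inverse (2 * \<alpha>)\<close> the limit also
    covers \<alpha> = 0, where T is constantly 0.\<close>
  have "T \<midarrow>0\<rightarrow> (1 - \<gamma> * 0 - 1) / (2 * \<alpha>)"
    unfolding T_def divide_inverse by (intro tendsto_intros S)
  then have "T \<midarrow>0\<rightarrow> 0" by simp
  from tendstoD[OF this r(1)] have "\<forall>\<^sub>F z in at 0. norm (T z) < r" by simp
  \<comment> \<open>Used twice: it keeps \<open>S z\<close> away from 0, and it selects the right
    square root when \<alpha> = 0.\<close>
  moreover have "\<forall>\<^sub>F z in at 0. dist (S z) 1 < 1 / 2"
    using S by (rule tendstoD) auto
  moreover have "((\<lambda>z::complex. C\<^sup>2 * norm z) \<longlongrightarrow> C\<^sup>2 * norm (0::complex)) (at 0)"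
    by (intro tendsto_intros)
  then have "\<forall>\<^sub>F z::complex in at 0. C\<^sup>2 * norm z < 1 / 8"
    by (rule order_tendstoD(2)) simp
  moreover have "((\<lambda>z. norm (\<gamma> * z)) \<longlongrightarrow> norm (\<gamma> * 0)) (at 0)"
    by (intro tendsto_intros)
  then have "\<forall>\<^sub>F z in at 0. norm (\<gamma> * z) < 1 / 2"
    by (rule order_tendstoD(2)) simp
  moreover have "\<forall>\<^sub>F z in at 0. (S z)\<^sup>2 = 1 + \<gamma>\<^sup>2 * z\<^sup>2 - 2 * (2 * \<alpha> * \<beta> + \<gamma>) * z"
    using S2 by (simp add: eventually_nhds_conv_at)
  moreover have "\<forall>\<^sub>F z in at 0. (z::complex) \<noteq> 0"
    by (simp add: eventually_at_filter)
  ultimately show ?thesis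
  proof eventually_elim
    case (elim z)
    have "growth A B \<alpha> \<beta> \<gamma> ^ 2 * norm z < 1" using elim by (simp add: C_def)
    note summable_diagonal[OF this]
    moreover have "diag_gf A B \<alpha> \<beta> \<gamma> z =
       (- B + \<beta>) / (\<beta> - B + \<alpha> * B\<^sup>2 * z + \<gamma> * B * z)
       + (2 * \<alpha> * z * (\<alpha> * B + \<beta> * A - A * B + \<gamma>) * (- 1 + \<gamma> * z + S z))
         / (S z * (- 1 + 2 * \<alpha> * B * z + \<gamma> * z + S z) * (2 * \<alpha> + A * (- 1 + \<gamma> * z + S z)))"
      if nz: "S z * (- 1 + 2 * \<alpha> * B * z + \<gamma> * z + S z) * (2 * \<alpha> + A * (- 1 + \<gamma> * z + S z)) \<noteq> 0"
    proof -
      \<comment> \<open>If \<alpha> = 0, the radicand is the square of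
        \<open>1 - \<gamma> * z\<close>. The root of opposite sign is impossible, since
        \<open>S z\<close> is within 1/2 of 1 and \<open>\<gamma> * z\<close> within 1/2 of
        0.\<close>
      have "\<alpha> \<noteq> 0"
      proof
        assume \<alpha>: "\<alpha> = 0"
        then have "(S z)\<^sup>2 = (1 - \<gamma> * z)\<^sup>2"
          using elim by (simp add: power2_eq_square algebra_simps)
        moreover have "S z \<noteq> - (1 - \<gamma> * z)"
        proof
          assume "S z = - (1 - \<gamma> * z)"
          then have "2 = (1 - S z) + \<gamma> * z" by simp
          then have "2 \<le> norm (1 - S z) + norm (\<gamma> * z)" by (metis norm_triangle_ineq norm_numeral)
          then show False using elim by (simp add: dist_norm norm_minus_commute)
        qed
        ultimately have "S z = 1 - \<gamma> * z" by (simp add: power2_eq_iff)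
        with \<alpha> nz show False by simp
      qed
      define t1 where "t1 = T z"
      have t1: "t1 = (1 - \<gamma> * z - S z) / (2 * \<alpha>)" by (simp add: t1_def T_def)
      then have Sz: "S z = 1 - \<gamma> * z - 2 * \<alpha> * t1" using \<open>\<alpha> \<noteq> 0\<close> by simp
      have "- 1 + 2 * \<alpha> * B * z + \<gamma> * z + S z = 2 * \<alpha> * (B * z - t1)"
        and "2 * \<alpha> + A * (- 1 + \<gamma> * z + S z) = 2 * \<alpha> * (1 - A * t1)"
        unfolding Sz by (simp_all add: algebra_simps)
      then have "B * z \<noteq> t1" "1 - A * t1 \<noteq> 0" "S z \<noteq> 0"
        using nz by auto
      have "C * (norm B * norm z) \<le> C * (C * norm z)"
        using \<open>norm B \<le> C\<close> C by (intro mult_left_mono mult_right_mono) auto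
      also have "\<dots> = C\<^sup>2 * norm z" by (simp add: power2_eq_square)
      also have "\<dots> < C * r" using elim r by simp
      finally have "norm (B * z) < r" using C by (simp add: norm_mult)
      \<comment> \<open>As \<open>C * r = 1 / 4\<close>, the left-hand sides are at most 1/2 and
        1/4, while \<open>norm (S z)\<close> exceeds 1/2.\<close>
      have "norm \<alpha> * (2 * r) \<le> C * (2 * r)" "norm A * r \<le> C * r"
        using \<open>norm \<alpha> \<le> C\<close> \<open>norm A \<le> C\<close> r by (auto intro!: mult_right_mono)
      moreover have "1 / 2 < norm (S z)"
        using elim norm_triangle_ineq2[of 1 "1 - S z"] by (simp add: dist_norm norm_minus_commute)
      ultimately have small: "norm \<alpha> * (2 * r) < norm (S z)" "norm A * r < 1" using r by auto
      \<comment> \<open>Up to the factor \<open>4 * \<alpha>\<close>, the two sides differ by the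
        radicand minus the square of \<open>S z\<close>, which is 0.\<close>
      have K: "t * (1 - \<gamma> * z) - \<alpha> * t\<^sup>2 - \<beta> * z = (t - t1) * (S z - \<alpha> * (t - t1))" for t
      proof -
        have "4 * \<alpha> * (t * (1 - \<gamma> * z) - \<alpha> * t\<^sup>2 - \<beta> * z - (t - t1) * (S z - \<alpha> * (t - t1)))
            = (1 + \<gamma>\<^sup>2 * z\<^sup>2 - 2 * (2 * \<alpha> * \<beta> + \<gamma>) * z) - (S z)\<^sup>2"
          unfolding Sz by (simp add: algebra_simps power2_eq_square)
        also have "\<dots> = 0" using elim by simp
        finally show ?thesis using \<open>\<alpha> \<noteq> 0\<close> by simp
      qed
      have "norm t1 < r" using elim by (simp add: t1_def)
      note kernel = kernel_contour_integral[OF this \<open>norm (B * z) < r\<close> \<open>B * z \<noteq> t1\<close> small(2,1) K]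
      have "(\<lambda>n. lattice_f A B \<alpha> \<beta> \<gamma> n n * z ^ n) sums
          ((1 - \<alpha> * t1) / ((1 - A * t1) * S z)
            + (B - \<beta>) * z / (B * z * (1 - \<gamma> * z) - \<alpha> * (B * z)\<^sup>2 - \<beta> * z)
            - (B - \<beta>) * z / ((B * z - t1) * S z))"
        by (rule diagonal_sums_contour_integral[OF _ _ kernel(2) kernel(1)])
          (use elim in \<open>simp_all add: r_def C_def\<close>)
      then show ?thesis
        unfolding diag_gf_def
        using residue_sum_eq[OF \<open>\<alpha> \<noteq> 0\<close> _ t1 _ \<open>S z \<noteq> 0\<close> \<open>B * z \<noteq> t1\<close> \<open>1 - A * t1 \<noteq> 0\<close>] elim
        by (simp add: sums_iff)
    qed
    ultimately show ?case by blast
  qed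
qed

end
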